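(* Let $\tau\ne0$ and, for small $\epsilon$, let $t_i=t_i(\epsilon)$, $i=1,\dots,N$, be a solution of the Bethe ansatz equations $$p\prod_{s=1}^2\frac{t_i-v_s}{t_i-q_2^{-1}v_s}\prod_{j=1}^N\frac{(q_1t_i-t_j)(q_2t_i-t_j)(q_3t_i-t_j)}{(q_1^{-1}t_i-t_j)(q_2^{-1}t_i-t_j)(q_3^{-1}t_i-t_j)}=-1,\qquad i=1,\dots,N,$$ with $q_1=e^{-(r-1)\epsilon}$, $q_2=e^{-\epsilon}$, $q_3=e^{r\epsilon}$, $p=e^{2\tau}$, and $v_s=1+\tilde v_s\epsilon+o(\epsilon)$. Then in the limit $\epsilon\to0$ (with $r,\tau,\tilde v_1,\tilde v_2$ fixed) we have the asymptotics $t_i=1+\tilde t_i\epsilon+o(\epsilon)$ for $i=1,\dots,N$. Moreover, the main terms $\tilde t_i$ satisfy the system of equations $$e^{2\tau}\prod_{s=1}^2\frac{\tilde t_i-\tilde v_s}{\tilde t_i-\tilde v_s-1}\prod_{j=1}^N\frac{\tilde t_i-\tilde t_j-1}{\tilde t_i-\tilde t_j+1}\ \frac{\tilde t_i-\tilde t_j+r}{\tilde t_i-\tilde t_j-r}\ \frac{\tilde t_i-\tilde t_j-r+1}{\tilde t_i-\tilde t_j+r-1}=-1,\qquad i=1,\dots,N.$$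
   Context: This is the Intermediate Long Wave limit of the Bethe ansatz equations of the quantum toroidal $\mathfrak{gl}_1$ algebra acting on a tensor product of two Fock modules: $q_1=x^{2(1-r)}$, $q_2=x^{-2}$, $q_3=x^{2r}$, $p=x^{2s}$ with $x^{2r}=e^h$, $x^{2s}=e^{2\tau}$, $\epsilon=h/r\to0$. The parameters $r$ and $\tau$ are real.
   Formalization: The t_i(ε) are assumed continuous in real ε on one side of 0 (jumping between solutions breaks the asymptotics), and the limit system is stated with denominators multiplied out, in the displayed form only where its denominators are nonzero (it can read 0/0). *)

theory Defs
  imports "HOL-Analysis.Analysis" "HOL-Library.Landau_Symbols"
begin

text \<open>
  Since division by zero yields zero, a vanishing denominator makes the left-hand side \<open>0\<close>,
  so \<open>bethe_equations\<close> entails that no denominator vanishes. In particular it entails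
  \<open>t i \<noteq> 0\<close> and (for \<open>N > 0\<close>) \<open>q1, q2, q3 \<noteq> 1\<close>, because of the factor \<open>j = i\<close>.
\<close>

definition bethe_equations ::
  "nat \<Rightarrow> complex \<Rightarrow> complex \<Rightarrow> complex \<Rightarrow> complex \<Rightarrow> (nat \<Rightarrow> complex) \<Rightarrow> (nat \<Rightarrow> complex) \<Rightarrow> bool"
where
  "bethe_equations N p q1 q2 q3 v t \<longleftrightarrow>
    (\<forall>i\<in>{1..N}.
      p * (\<Prod>s\<in>{1..2}. (t i - v s) / (t i - inverse q2 * v s)) *
      (\<Prod>j\<in>{1..N}.
        ((q1 * t i - t j) * (q2 * t i - t j) * (q3 * t i - t j)) /
        ((inverse q1 * t i - t j) * (inverse q2 * t i - t j) * (inverse q3 * t i - t j)))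
      = -1)"

definition ilw_lhs ::
  "nat \<Rightarrow> real \<Rightarrow> real \<Rightarrow> (nat \<Rightarrow> complex) \<Rightarrow> (nat \<Rightarrow> complex) \<Rightarrow> nat \<Rightarrow> complex"
where
  "ilw_lhs N r \<tau> w u i =
    exp (2 * of_real \<tau>) * (\<Prod>s\<in>{1..2}. (u i - w s) / (u i - w s - 1)) *
    (\<Prod>j\<in>{1..N}.
      (u i - u j - 1) / (u i - u j + 1) *
      ((u i - u j + of_real r) / (u i - u j - of_real r)) *
      ((u i - u j - of_real r + 1) / (u i - u j + of_real r - 1)))"

text \<open>
  The fractions in \<open>ilw_lhs\<close> can become \<open>0 / 0\<close> at the main terms of a solution of the Bethe
  equations: for exceptional parameters the numerators and denominators of the Bethe equations
  may vanish to higher order than \<open>\<epsilon>\<close>. This happens for instance with \<open>N = 2\<close> and main terms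
  \<open>w 1 + 1\<close>, \<open>w 1\<close>. The numerator and the denominator of \<open>ilw_lhs\<close> are therefore named
  separately, so that the limiting equation also makes sense in that case.
\<close>

definition ilw_num ::
  "nat \<Rightarrow> real \<Rightarrow> real \<Rightarrow> (nat \<Rightarrow> complex) \<Rightarrow> (nat \<Rightarrow> complex) \<Rightarrow> nat \<Rightarrow> complex"
where
  "ilw_num N r \<tau> w u i =
    exp (2 * of_real \<tau>) * (\<Prod>s\<in>{1..2}. u i - w s) *
    (\<Prod>j\<in>{1..N}.
      (u i - u j - 1) * (u i - u j + of_real r) * (u i - u j - of_real r + 1))"

definition ilw_den ::
  "nat \<Rightarrow> real \<Rightarrow> (nat \<Rightarrow> complex) \<Rightarrow> (nat \<Rightarrow> complex) \<Rightarrow> nat \<Rightarrow> complex"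
where
  "ilw_den N r w u i =
    (\<Prod>s\<in>{1..2}. u i - w s - 1) *
    (\<Prod>j\<in>{1..N}.
      (u i - u j + 1) * (u i - u j - of_real r) * (u i - u j + of_real r - 1))"

lemma ilw_lhs_eq: "ilw_lhs N r \<tau> w u i = ilw_num N r \<tau> w u i / ilw_den N r w u i"
  unfolding ilw_lhs_def ilw_num_def ilw_den_def
  by (simp add: prod_dividef prod.distrib)

end

theory Submission
  imports Defs "HOL-Library.Function_Algebras"
begin

text \<open>
  Put \<open>t i = 1 + \<epsilon> * y i\<close>. If \<open>y\<close> stays bounded, every cluster point of \<open>y\<close> at \<open>\<epsilon> \<rightarrow> 0\<close> solves a
  limiting system of polynomial equations; if that system has only finitely many solutions, then
  \<open>y\<close>, being continuous on an interval, has to converge. Both boundedness and finiteness fail to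
  follow from the limits of the individual Bethe equations, because numerator and denominator can
  vanish together: for \<open>N = 3\<close> the points \<open>u 1 = a\<close>, \<open>u 2 = a - 1\<close>, \<open>u 3 = a - 1 + r\<close> satisfy
  \<open>ilw_num = 0 = ilw_den\<close> for all three indices and every \<open>a\<close>.

  The remedy is to multiply the Bethe equations over an arbitrary set \<open>C\<close> of indices. Since
  \<open>q1 * q2 * q3 = 1\<close>, the two-particle factors with both indices in \<open>C\<close> cancel exactly
  (\<open>bethe_cluster_equation\<close>), and what is left has a limit that retains information about
  \<open>C\<close> as a whole (\<open>cluster_system_limit\<close>). In this limit the leading form of the
  equation of \<open>C\<close> is
  \<open>(p ^ card C - 1) * (\<Prod>i\<in>C. u i ^ 2 * (\<Prod>j\<in>I - C. (u i - u j) ^ 3))\<close>, whose first factor is nonzero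
  as \<open>\<tau> \<noteq> 0\<close>. These leading forms have no common zero except \<open>0\<close>: if \<open>u k \<noteq> 0\<close>, the form of
  \<open>C = {i. u i = u k}\<close> does not vanish at \<open>u\<close>.

  This one observation is used twice. Analytically, if \<open>y\<close> were unbounded, then rescaling
  \<open>t - 1\<close> to norm one instead of dividing it by \<open>\<epsilon>\<close> would produce a nonzero common zero of the
  leading forms (\<open>bethe_solutions_bounded\<close>). Algebraically, a polynomial system whose leading forms
  have only the trivial common zero has finitely many solutions (\<open>finite_cluster_solutions\<close>).
  For the latter, the coordinate functions on the solution set are shown to be nilpotent in the
  associated graded ring of the degree filtration, so the polynomial functions on the solution set
  form a finite-dimensional space, and each coordinate takes finitely many values.
  The limiting equation for a single index is the equation of the set \<open>{i}\<close>.
\<close>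

section \<open>Nilpotency in the associated graded ring of a degree filtration\<close>

text \<open>
  Think of \<open>V d\<close> as the elements of degree less than \<open>d\<close>, so that \<open>V 0\<close> would be \<open>{0}\<close> and
  \<open>V (Suc d)\<close> modulo \<open>V d\<close> is the part of degree \<open>d\<close> of the associated graded ring. The shift by
  one avoids degrees below zero: a product of elements of degree at most \<open>d\<close> and less than \<open>e\<close>
  has degree less than \<open>d + e\<close>, also if \<open>e = 0\<close>.
\<close>

locale degree_filtration =
  fixes V :: "nat \<Rightarrow> 'b::comm_ring_1 set"
  assumes zero: "0 \<in> V d"
    and diff: "f \<in> V d \<Longrightarrow> g \<in> V d \<Longrightarrow> f - g \<in> V d"
    and one: "1 \<in> V (Suc 0)"
    and mult: "f \<in> V (Suc d) \<Longrightarrow> g \<in> V e \<Longrightarrow> f * g \<in> V (d + e)"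
begin

lemma minus: "f \<in> V d \<Longrightarrow> - f \<in> V d"
  using diff[OF zero, of f d] by simp

lemma add: "f \<in> V d \<Longrightarrow> g \<in> V d \<Longrightarrow> f + g \<in> V d"
  using diff[of f d "- g"] minus[of g d] by simp

lemma sum: "(\<And>i. i \<in> A \<Longrightarrow> f i \<in> V d) \<Longrightarrow> sum f A \<in> V d"
  by (induction A rule: infinite_finite_induct) (auto intro: zero add)

lemma of_nat_mult: "f \<in> V d \<Longrightarrow> of_nat n * f \<in> V d"
  by (induction n) (auto simp: distrib_right intro: zero add)

lemma mult_Suc: "f \<in> V (Suc d) \<Longrightarrow> g \<in> V (Suc e) \<Longrightarrow> f * g \<in> V (Suc (d + e))"
  using mult[of f d g "Suc e"] by simp

lemma power: "f \<in> V (Suc d) \<Longrightarrow> f ^ n \<in> V (Suc (n * d))"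
  by (induction n) (auto intro: one mult_Suc)

lemma prod:
  "(\<And>i. i \<in> A \<Longrightarrow> f i \<in> V (Suc d)) \<Longrightarrow> prod f A \<in> V (Suc (card A * d))"
  by (induction A rule: infinite_finite_induct) (auto intro: one mult_Suc)

text \<open>
  The symbol of \<open>f\<close> in degree \<open>d\<close> of the associated graded ring is nilpotent. Working with
  representatives and a declared degree avoids constructing the graded ring.
\<close>

definition gr_nilpotent :: "nat \<Rightarrow> 'b \<Rightarrow> bool" where
  "gr_nilpotent d f \<longleftrightarrow> f \<in> V (Suc d) \<and> (\<exists>n>0. f ^ n \<in> V (n * d))"

lemma gr_nilpotent_if_lower_degree: "f \<in> V (Suc d) \<Longrightarrow> f \<in> V d \<Longrightarrow> gr_nilpotent d f"
  unfolding gr_nilpotent_def by (auto intro!: exI[of _ 1])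

lemma gr_nilpotent_zero: "gr_nilpotent d 0"
  by (simp add: gr_nilpotent_if_lower_degree zero)

lemma gr_nilpotent_mult:
  assumes "gr_nilpotent d f" "g \<in> V (Suc e)"
  shows "gr_nilpotent (d + e) (g * f)"
proof -
  from assms obtain n where n: "n > 0" "f ^ n \<in> V (n * d)" and f: "f \<in> V (Suc d)"
    unfolding gr_nilpotent_def by blast
  have "(g * f) ^ n \<in> V (n * (d + e))"
    using mult[OF power[OF assms(2), of n] n(2)]
    by (simp add: power_mult_distrib distrib_left add.commute)
  then show ?thesis
    unfolding gr_nilpotent_def using n(1) mult_Suc[OF assms(2) f] by (auto simp: add.commute)
qed

lemma gr_nilpotent_minus: "gr_nilpotent d f \<Longrightarrow> gr_nilpotent d (- f)"
  using gr_nilpotent_mult[of d f "-1" 0] minus[OF one] by simp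

text \<open>
  As usual for nilpotent elements: in the binomial expansion of \<open>(f + g) ^ (n + m)\<close> every term
  contains \<open>f ^ n\<close> or \<open>g ^ m\<close>.
\<close>

lemma gr_nilpotent_add:
  assumes "gr_nilpotent d f" "gr_nilpotent d g"
  shows "gr_nilpotent d (f + g)"
proof -
  from assms obtain n m where n: "n > 0" "f ^ n \<in> V (n * d)" and f: "f \<in> V (Suc d)"
    and m: "m > 0" "g ^ m \<in> V (m * d)" and g: "g \<in> V (Suc d)"
    unfolding gr_nilpotent_def by blast
  have "f ^ k * g ^ (n + m - k) \<in> V ((n + m) * d)" if k: "k \<le> n + m" for k
  proof (cases "n \<le> k")
    case True
    have e: "(k - n) * d + (n + m - k) * d + n * d = (n + m) * d"
      using True k by (simp flip: distrib_right)
    have "f ^ (k - n) * g ^ (n + m - k) * f ^ n \<in> V ((n + m) * d)"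
      using mult[OF mult_Suc[OF power[OF f] power[OF g]] n(2), of "k - n" "n + m - k"] e
      by simp
    also have "f ^ (k - n) * g ^ (n + m - k) * f ^ n = f ^ (k - n + n) * g ^ (n + m - k)"
      by (simp only: power_add mult_ac)
    finally show ?thesis using True by simp
  next
    case False
    have e: "k * d + (n - k) * d + m * d = (n + m) * d"
      using False k by (simp flip: distrib_right)
    have "f ^ k * g ^ (n - k) * g ^ m \<in> V ((n + m) * d)"
      using mult[OF mult_Suc[OF power[OF f] power[OF g]] m(2), of k "n - k"] e
      by simp
    also have "f ^ k * g ^ (n - k) * g ^ m = f ^ k * g ^ (n - k + m)"
      by (simp only: power_add mult_ac)
    also have "n - k + m = n + m - k" using False by simp
    finally show ?thesis .
  qed
  then have "(f + g) ^ (n + m) \<in> V ((n + m) * d)"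
    unfolding binomial_ring by (auto intro!: sum of_nat_mult simp: mult.assoc)
  then show ?thesis
    unfolding gr_nilpotent_def using n(1) add[OF f g] by (auto intro!: exI[of _ "n + m"])
qed

lemma gr_nilpotent_root:
  assumes "gr_nilpotent (m * d) (f ^ m)" "f \<in> V (Suc d)" "m > 0"
  shows "gr_nilpotent d f"
proof -
  from assms obtain n where n: "n > 0" "(f ^ m) ^ n \<in> V (n * (m * d))"
    unfolding gr_nilpotent_def by blast
  then show ?thesis
    unfolding gr_nilpotent_def using assms(2,3)
    by (auto intro!: exI[of _ "m * n"] simp: power_mult mult_ac)
qed

text \<open>
  Congruence of symbols modulo the elements that \<open>X\<close> multiplies into the nilradical; informally,
  equality in the reduced graded ring once \<open>X\<close> is inverted.
\<close>

definition gr_cong :: "'b \<Rightarrow> nat \<Rightarrow> nat \<Rightarrow> 'b \<Rightarrow> 'b \<Rightarrow> bool" where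
  "gr_cong X e d f g \<longleftrightarrow>
    X \<in> V (Suc e) \<and> f \<in> V (Suc d) \<and> g \<in> V (Suc d) \<and> gr_nilpotent (d + e) (X * (f - g))"

lemma gr_cong_mult:
  assumes "gr_cong X e d f g" "gr_cong X e d' f' g'"
  shows "gr_cong X e (d + d') (f * f') (g * g')"
proof -
  have *: "gr_nilpotent (d + e) (X * (f - g))" "gr_nilpotent (d' + e) (X * (f' - g'))" "X \<in> V (Suc e)"
    "f \<in> V (Suc d)" "g \<in> V (Suc d)" "f' \<in> V (Suc d')" "g' \<in> V (Suc d')"
    using assms by (auto simp: gr_cong_def)
  have "gr_nilpotent (d + e + d') (f' * (X * (f - g)) + g * (X * (f' - g')))"
    by (intro gr_nilpotent_add)
      (use gr_nilpotent_mult[OF *(1) *(6)] gr_nilpotent_mult[OF *(2) *(5)] in \<open>simp_all add: add_ac\<close>)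
  also have "f' * (X * (f - g)) + g * (X * (f' - g')) = X * (f * f' - g * g')"
    by (simp add: algebra_simps)
  finally show ?thesis
    using * by (auto simp: gr_cong_def mult_Suc add_ac)
qed

lemma gr_cong_refl: "X \<in> V (Suc e) \<Longrightarrow> f \<in> V (Suc d) \<Longrightarrow> gr_cong X e d f f"
  by (simp add: gr_cong_def gr_nilpotent_zero)

lemma gr_cong_prod:
  assumes "X \<in> V (Suc e)" "\<And>i. i \<in> A \<Longrightarrow> gr_cong X e d (f i) (g i)"
  shows "gr_cong X e (card A * d) (prod f A) (prod g A)"
  using assms(2)
  by (induction A rule: infinite_finite_induct)
    (auto intro: gr_cong_mult gr_cong_refl assms(1) one)

text \<open>
  For each \<open>C\<close> put \<open>X C = x k * (\<Prod>j\<in>I - C. x k - x j)\<close>. By induction on \<open>C \<ni> k\<close>, \<open>X C\<close> is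
  nilpotent; \<open>C = I\<close> is the claim. For the step, \<open>X (C - {i}) = X C * (x k - x i)\<close> is nilpotent by
  the induction hypothesis, so \<open>X C\<close> cannot distinguish \<open>x i\<close> with \<open>i \<in> C\<close> from \<open>x k\<close>. The
  product assumed nilpotent for \<open>C\<close> is therefore congruent to \<open>X C ^ card C\<close>, and a power of
  \<open>X C\<close> is nilpotent. This is the graded counterpart of the choice \<open>C = {i. u i = u k}\<close> that shows
  the absence of nonzero common zeros, and it needs no prime ideals.
\<close>

theorem gr_nilpotent_generators:
  fixes x :: "'i \<Rightarrow> 'b"
  assumes "finite I"
    and x: "\<And>i. i \<in> I \<Longrightarrow> x i \<in> V (Suc 1)"
    and M: "\<And>C. C \<subseteq> I \<Longrightarrow> C \<noteq> {} \<Longrightarrow>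
      gr_nilpotent (card C * (1 + card (I - C))) (\<Prod>i\<in>C. x i * (\<Prod>j\<in>I - C. x i - x j))"
    and k: "k \<in> I"
  shows "gr_nilpotent 1 (x k)"
proof -
  define X where "X = (\<lambda>C. x k * (\<Prod>j\<in>I - C. x k - x j))"
  define e where "e = (\<lambda>C. 1 + card (I - C))"
  have a: "x i - x j \<in> V (Suc 1)" if "i \<in> I" "j \<in> I" for i j
    using that by (intro diff x)
  have XV: "X C \<in> V (Suc (e C))" for C
    unfolding X_def e_def using mult_Suc[OF x[OF k] prod[of "I - C" "\<lambda>j. x k - x j" 1]] a k
    by simp
  have "gr_nilpotent (e C) (X C)" if "C \<subseteq> I" "k \<in> C" for C
    using finite_subset[OF that(1) assms(1)] that
  proof (induction C rule: finite_psubset_induct)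
    case (psubset C)
    have red: "gr_nilpotent (Suc (e C)) (X C * (x i - x k))" if i: "i \<in> C" for i
    proof (cases "i = k")
      case True
      then show ?thesis by (simp add: gr_nilpotent_zero)
    next
      case False
      have eq: "I - (C - {i}) = insert i (I - C)" "i \<notin> I - C"
        using i psubset.prems by auto
      have "X (C - {i}) = X C * (x k - x i)"
        unfolding X_def eq(1) using eq(2) assms(1) by (simp add: mult_ac)
      moreover have "e (C - {i}) = Suc (e C)"
        unfolding e_def eq(1) using eq(2) assms(1) by simp
      moreover have "gr_nilpotent (e (C - {i})) (X (C - {i}))"
        using psubset.IH[of "C - {i}"] i False psubset.prems by auto
      ultimately have "gr_nilpotent (Suc (e C)) (- (X C * (x k - x i)))"
        using gr_nilpotent_minus by simp
      then show ?thesis by (simp add: algebra_simps)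
    qed
    have c: "gr_cong (X C) (e C) (e C) (x i * (\<Prod>j\<in>I - C. x i - x j)) (X C)" if i: "i \<in> C" for i
    proof -
      have "i \<in> I" using i psubset.prems by auto
      have "gr_cong (X C) (e C) 1 (x i) (x k)"
        using red[OF i] XV x \<open>i \<in> I\<close> k by (simp add: gr_cong_def)
      moreover have "gr_cong (X C) (e C) 1 (x i - x j) (x k - x j)" if "j \<in> I - C" for j
        using red[OF i] XV a \<open>i \<in> I\<close> k that by (simp add: gr_cong_def)
      ultimately have "gr_cong (X C) (e C) (1 + card (I - C) * 1)
          (x i * (\<Prod>j\<in>I - C. x i - x j)) (x k * (\<Prod>j\<in>I - C. x k - x j))"
        by (intro gr_cong_mult gr_cong_prod XV)
      then show ?thesis by (simp add: e_def X_def)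
    qed
    have fC: "finite C" "C \<noteq> {}" using psubset by auto
    then have c0: "card C > 0" by (simp add: card_gt_0_iff)
    let ?M = "\<Prod>i\<in>C. x i * (\<Prod>j\<in>I - C. x i - x j)"
    have "gr_cong (X C) (e C) (card C * e C) ?M (\<Prod>i\<in>C. X C)"
      by (intro gr_cong_prod XV c)
    then have "gr_nilpotent (card C * e C + e C) (X C * (?M - X C ^ card C))"
      by (simp add: gr_cong_def)
    moreover have "gr_nilpotent (card C * e C + e C) (X C * ?M)"
      using gr_nilpotent_mult[OF M[OF psubset.prems(1) fC(2)] XV[of C]] by (simp add: e_def)
    ultimately have "gr_nilpotent (card C * e C + e C) (X C * ?M + - (X C * (?M - X C ^ card C)))"
      by (intro gr_nilpotent_add gr_nilpotent_minus)
    then have "gr_nilpotent (Suc (card C) * e C) (X C ^ Suc (card C))"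
      by (simp add: algebra_simps)
    then show ?case by (rule gr_nilpotent_root) (auto intro: XV)
  qed
  from this[of I] k show ?thesis by (simp add: X_def e_def)
qed

end

section \<open>Polynomial functions of bounded degree\<close>

lemma power_fun_apply [simp]: "(f ^ n) s = (f s :: complex) ^ n"
  by (induction n) auto

lemma prod_fun_apply [simp]: "prod f A s = (\<Prod>i\<in>A. f i s :: complex)"
  by (induction A rule: infinite_finite_induct) auto

interpretation fun_space: vector_space "\<lambda>(c::complex) (f::'a \<Rightarrow> complex) s. c * f s"
  by unfold_locales (auto simp: fun_eq_iff algebra_simps)

text \<open>
  Functions are multiplied pointwise, so that the coordinates \<open>x i\<close> are elements of a commutative
  ring and polynomials in them are honest functions on the type \<open>'a\<close>.
\<close>

definition monomial :: "'i set \<Rightarrow> ('i \<Rightarrow> 'a \<Rightarrow> complex) \<Rightarrow> ('i \<Rightarrow> nat) \<Rightarrow> 'a \<Rightarrow> complex" where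
  "monomial I x e = (\<Prod>i\<in>I. x i ^ e i)"

definition polys_below :: "'i set \<Rightarrow> ('i \<Rightarrow> 'a \<Rightarrow> complex) \<Rightarrow> nat \<Rightarrow> ('a \<Rightarrow> complex) set" where
  "polys_below I x d = fun_space.span {monomial I x e |e. sum e I < d}"

lemma monomial_mult: "monomial I x e * monomial I x e' = monomial I x (\<lambda>i. e i + e' i)"
  by (simp add: monomial_def power_add prod.distrib)

lemma monomial_in_polys_below: "sum e I < d \<Longrightarrow> monomial I x e \<in> polys_below I x d"
  unfolding polys_below_def by (rule fun_space.span_base) blast

lemma polys_below_mult:
  assumes f: "f \<in> polys_below I x (Suc d)" and g: "g \<in> polys_below I x d'"
  shows "f * g \<in> polys_below I x (d + d')"
proof -
  have gen: "monomial I x e * g \<in> polys_below I x (d + d')" if e: "sum e I < Suc d" for e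
    using g[unfolded polys_below_def]
  proof (induction g rule: fun_space.span_induct)
    show "fun_space.subspace {a. monomial I x e * a \<in> polys_below I x (d + d')}"
    proof (rule fun_space.subspaceI, goal_cases)
      case 1
      show ?case by (simp add: polys_below_def fun_space.span_zero)
    next
      case (2 a b)
      then show ?case
        by (simp add: polys_below_def distrib_left fun_space.span_add)
    next
      case (3 c a)
      have "monomial I x e * (\<lambda>s. c * a s) = (\<lambda>s. c * (monomial I x e * a) s)"
        by (simp add: fun_eq_iff)
      with 3 show ?case
        by (simp add: polys_below_def fun_space.span_scale del: times_fun_apply)
    qed
  next
    fix a assume "a \<in> {monomial I x e |e. sum e I < d'}"
    then obtain e' where e': "a = monomial I x e'" "sum e' I < d'" by blast
    show "monomial I x e * a \<in> polys_below I x (d + d')"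
      unfolding e' monomial_mult
      by (rule monomial_in_polys_below) (use e e' in \<open>simp add: sum.distrib\<close>)
  qed
  show ?thesis
    using f[unfolded polys_below_def]
  proof (induction f rule: fun_space.span_induct)
    show "fun_space.subspace {a. a * g \<in> polys_below I x (d + d')}"
    proof (rule fun_space.subspaceI, goal_cases)
      case 1
      show ?case by (simp add: polys_below_def fun_space.span_zero)
    next
      case (2 a b)
      then show ?case
        by (simp add: polys_below_def distrib_right fun_space.span_add)
    next
      case (3 c a)
      have "(\<lambda>s. c * a s) * g = (\<lambda>s. c * (a * g) s)"
        by (simp add: fun_eq_iff)
      with 3 show ?case
        by (simp add: polys_below_def fun_space.span_scale del: times_fun_apply)
    qed
  qed (use gen in blast)
qed

lemma monomial_zero: "monomial I x (\<lambda>_. 0) = 1"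
  by (simp add: monomial_def)

lemma const_in_polys_below: "(\<lambda>_. c) \<in> polys_below I x (Suc d)"
proof -
  have "(\<lambda>s. c * monomial I x (\<lambda>_. 0) s) \<in> polys_below I x (Suc d)"
    unfolding polys_below_def
    by (intro fun_space.span_scale) (auto intro!: fun_space.span_base exI[of _ "\<lambda>_. 0"])
  then show ?thesis by (simp add: monomial_zero)
qed

lemma generator_in_polys_below:
  assumes "finite I" "i \<in> I"
  shows "x i \<in> polys_below I x (Suc 1)"
proof -
  let ?e = "\<lambda>j. if j = i then 1 else 0 :: nat"
  have "monomial I x ?e = (\<Prod>j\<in>I. if j = i then x i else 1)"
    unfolding monomial_def by (intro prod.cong) auto
  also have "\<dots> = x i" using assms by simp
  finally show ?thesis
    using monomial_in_polys_below[of ?e I "Suc 1" x] assms by simp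
qed

lemma polys_below_filtration: "degree_filtration (polys_below I x)"
proof
  show "1 \<in> polys_below I x (Suc 0)"
    using const_in_polys_below[of 1] by (simp add: one_fun_def)
next
  show "0 \<in> polys_below I x d" for d
    unfolding polys_below_def by (rule fun_space.span_zero)
next
  show "f - g \<in> polys_below I x d" if "f \<in> polys_below I x d" "g \<in> polys_below I x d" for f g d
    using that unfolding polys_below_def by (rule fun_space.span_diff)
qed (rule polys_below_mult)

text \<open>
  A monomial with an exponent \<open>e k \<ge> n k\<close> contains the factor \<open>x k ^ n k\<close>, which is a polynomial
  of lower degree. Rewriting terminates at monomials with all exponents \<open>e i < n i\<close>.
\<close>

lemma polys_below_in_finite_span:
  assumes I: "finite I" and n: "\<And>i. i \<in> I \<Longrightarrow> x i ^ n i \<in> polys_below I x (n i)"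
  shows "polys_below I x d \<subseteq> fun_space.span (monomial I x ` (PiE I (\<lambda>i. {..<n i})))"
    (is "_ \<subseteq> fun_space.span ?B")
proof (induction d rule: less_induct)
  case (less d)
  have "monomial I x e \<in> fun_space.span ?B" if e: "sum e I < d" for e
  proof (cases "\<forall>i\<in>I. e i < n i")
    case True
    have "monomial I x e = monomial I x (restrict e I)"
      unfolding monomial_def by (intro prod.cong) auto
    moreover have "restrict e I \<in> PiE I (\<lambda>i. {..<n i})"
      using True by auto
    ultimately show ?thesis by (auto intro: fun_space.span_base)
  next
    case False
    then obtain k where k: "k \<in> I" "n k \<le> e k" by auto
    let ?e = "e(k := e k - n k)"
    have s: "sum e I = sum ?e I + n k"
      using I k by (simp add: sum.remove[of I k])
    have "x k ^ e k = x k ^ (e k - n k) * x k ^ n k"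
      using k by (simp flip: power_add)
    then have "monomial I x e = monomial I x ?e * x k ^ n k"
      unfolding monomial_def using I k by (simp add: prod.remove[of I k] mult_ac)
    also have "\<dots> \<in> polys_below I x (sum e I)"
      unfolding s by (intro polys_below_mult n k monomial_in_polys_below) simp
    finally show ?thesis using less.IH[OF e] by blast
  qed
  then show ?case
    unfolding polys_below_def[of I x d]
    by (intro fun_space.span_minimal fun_space.subspace_span) auto
qed

lemma power_sum_eq_zero_imp:
  assumes inf: "infinite (range f)" and A: "finite A"
    and eq: "\<And>s. (\<Sum>m\<in>A. c m * (f s :: complex) ^ m) = 0" and m: "m \<in> A"
  shows "c m = 0"
proof -
  define c' where "c' = (\<lambda>m. if m \<in> A then c m else 0)"
  obtain n where n: "A \<subseteq> {..n}" using A by (meson finite_nat_iff_bounded_le)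
  have "(\<Sum>m\<le>n. c' m * z ^ m) = 0" if "z \<in> range f" for z
  proof -
    have "(\<Sum>m\<le>n. c' m * z ^ m) = (\<Sum>m\<in>A. c m * z ^ m)"
      using n by (intro sum.mono_neutral_cong_right) (auto simp: c'_def)
    then show ?thesis using that eq by auto
  qed
  then have "range f \<subseteq> {z. (\<Sum>m\<le>n. c' m * z ^ m) = 0}" by auto
  then have "infinite {z. (\<Sum>m\<le>n. c' m * z ^ m) = 0}"
    using inf finite_subset by blast
  then have "c' m = 0"
    using polyfun_finite_roots[of c' n] n m by auto
  then show ?thesis using m by (simp add: c'_def)
qed

text \<open>
  If \<open>f\<close> took infinitely many values, its powers would be linearly independent, since a nonzero
  polynomial in one variable has finitely many roots.
\<close>

lemma finite_range_if_powers_in_finite_span: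
  assumes B: "finite B" and f: "\<And>m. f ^ m \<in> fun_space.span B"
  shows "finite (range f)"
proof (rule ccontr)
  assume inf: "infinite (range f)"
  have inj: "inj (\<lambda>m. f ^ m)"
  proof (rule injI, rule ccontr)
    fix m n :: nat assume eq: "f ^ m = f ^ n" and "m \<noteq> n"
    have "(\<Sum>j\<in>{m, n}. (if j = m then 1 else -1) * f s ^ j) = 0" for s
      using \<open>m \<noteq> n\<close> arg_cong[OF eq, of "\<lambda>g. g s"] by simp
    from power_sum_eq_zero_imp[OF inf _ this, of m] show False by simp
  qed
  have "fun_space.independent (range (\<lambda>m. f ^ m))"
    unfolding fun_space.dependent_explicit
  proof safe
    fix T u g assume T: "finite T" "T \<subseteq> range (\<lambda>m. f ^ m)" and g: "g \<in> T" "u g \<noteq> 0"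
      and eq: "(\<Sum>v\<in>T. (\<lambda>s. u v * v s)) = 0"
    obtain A where A: "T = (\<lambda>m. f ^ m) ` A" "finite A"
      using finite_subset_image[OF T] by blast
    have "(\<Sum>m\<in>A. u (f ^ m) * f s ^ m) = 0" for s
    proof -
      have "(\<Sum>m\<in>A. u (f ^ m) * f s ^ m) = (\<Sum>v\<in>T. u v * v s)"
        unfolding A using inj by (subst sum.reindex) (auto intro: inj_on_subset)
      also have "\<dots> = (\<Sum>v\<in>T. (\<lambda>s. u v * v s)) s"
        using T(1) by (induction T rule: finite_induct) auto
      finally show ?thesis using eq by simp
    qed
    from power_sum_eq_zero_imp[OF inf A(2) this] g A show False by auto
  qed
  then have "finite (range (\<lambda>m. f ^ m))"
    using fun_space.independent_span_bound[OF B] f by blast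
  then show False using inj finite_imageD by blast
qed

lemma finite_range_generator:
  assumes I: "finite I" and gr_nilpotent: "\<And>i. i \<in> I \<Longrightarrow> degree_filtration.gr_nilpotent (polys_below I x) 1 (x i)" and k: "k \<in> I"
  shows "finite (range (x k))"
proof -
  interpret polys: degree_filtration "polys_below I x" by (rule polys_below_filtration)
  obtain n where n: "\<And>i. i \<in> I \<Longrightarrow> x i ^ n i \<in> polys_below I x (n i)"
    using gr_nilpotent unfolding polys.gr_nilpotent_def by (metis mult.right_neutral)
  let ?B = "monomial I x ` (PiE I (\<lambda>i. {..<n i}))"
  have "x k ^ m \<in> fun_space.span ?B" for m
    using polys.power[OF generator_in_polys_below[OF I k], of m]
      polys_below_in_finite_span[where d = "Suc (m * 1)" and n = n, OF I n] by blast
  moreover have "finite ?B" using I by (intro finite_imageI finite_PiE) auto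
  ultimately show ?thesis by (rule finite_range_if_powers_in_finite_span[rotated])
qed

section \<open>Cluster equations and the finiteness of their solution set\<close>

text \<open>
  The shape shared by numerators and denominators of a product of Bethe equations over \<open>C\<close> after
  cancellation: two one-particle factors \<open>A\<close> for each member of \<open>C\<close>, and three two-particle factors
  \<open>B\<close> for each pair that leaves \<open>C\<close>.
\<close>

definition cluster_prod ::
  "'i set \<Rightarrow> 'i set \<Rightarrow> ('i \<Rightarrow> nat \<Rightarrow> 'b) \<Rightarrow> ('i \<Rightarrow> 'i \<Rightarrow> nat \<Rightarrow> 'b) \<Rightarrow> 'b::comm_monoid_mult" where
  "cluster_prod I C A B =
    (\<Prod>i\<in>C. (\<Prod>s\<in>{1..2}. A i s) * (\<Prod>j\<in>I - C. \<Prod>a\<in>{1..3}. B i j a))"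

text \<open>
  The limiting equations, one for each set \<open>C\<close> of indices. In the application \<open>\<omega>\<close> and \<open>\<kappa>\<close> are the
  first-order coefficients of \<open>v\<close> and \<open>q\<close>; at \<open>\<omega> = \<kappa> = 0\<close> only the leading forms remain.
\<close>

definition cluster_system ::
  "'i set \<Rightarrow> complex \<Rightarrow> (nat \<Rightarrow> complex) \<Rightarrow> (nat \<Rightarrow> complex) \<Rightarrow> ('i \<Rightarrow> complex) \<Rightarrow> bool" where
  "cluster_system I p \<omega> \<kappa> u \<longleftrightarrow>
    (\<forall>C\<subseteq>I. p ^ card C *
        cluster_prod I C (\<lambda>i s. u i - \<omega> s) (\<lambda>i j a. u i - u j + \<kappa> a) =
      cluster_prod I C (\<lambda>i s. u i - \<omega> s + \<kappa> 2) (\<lambda>i j a. u i - u j - \<kappa> a))"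

lemma cluster_prod_scale:
  "cluster_prod I C (\<lambda>i s. c * A i s) (\<lambda>i j a. c * B i j a) =
    c ^ (card C * (2 + card (I - C) * 3)) * cluster_prod I C A B"
  unfolding cluster_prod_def
  by (simp add: prod.distrib power_add power_mult mult_ac del: Diff_iff)
    (simp add: power_mult_distrib mult_ac flip: power_mult)

lemma cluster_prod_cong:
  assumes "\<And>i s. i \<in> C \<Longrightarrow> s \<in> {1..2} \<Longrightarrow> A i s = A' i s"
    and "\<And>i j a. i \<in> C \<Longrightarrow> j \<in> I - C \<Longrightarrow> a \<in> {1..3} \<Longrightarrow> B i j a = B' i j a"
  shows "cluster_prod I C A B = cluster_prod I C A' B'"
  unfolding cluster_prod_def using assms
  by (intro prod.cong arg_cong2[of _ _ _ _ "(*)"] refl)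

lemma tendsto_cluster_prod:
  fixes A :: "'i \<Rightarrow> nat \<Rightarrow> 'e \<Rightarrow> complex"
  assumes "\<And>i s. i \<in> C \<Longrightarrow> s \<in> {1..2} \<Longrightarrow> (A i s \<longlongrightarrow> A' i s) F"
    and "\<And>i j a. i \<in> C \<Longrightarrow> j \<in> I - C \<Longrightarrow> a \<in> {1..3} \<Longrightarrow> (B i j a \<longlongrightarrow> B' i j a) F"
  shows "((\<lambda>\<epsilon>. cluster_prod I C (\<lambda>i s. A i s \<epsilon>) (\<lambda>i j a. B i j a \<epsilon>)) \<longlongrightarrow> cluster_prod I C A' B') F"
  unfolding cluster_prod_def using assms by (intro tendsto_prod tendsto_mult)

lemma cluster_prod_fun_apply:
  fixes A :: "'i \<Rightarrow> nat \<Rightarrow> 'e \<Rightarrow> complex"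
  shows "cluster_prod I C A B \<epsilon> = cluster_prod I C (\<lambda>i s. A i s \<epsilon>) (\<lambda>i j a. B i j a \<epsilon>)"
  unfolding cluster_prod_def by simp

lemma (in degree_filtration) gr_cong_cluster_prod:
  assumes "\<And>i s. i \<in> C \<Longrightarrow> s \<in> {1..2} \<Longrightarrow> gr_cong 1 0 1 (A i s) (A' i s)"
    and "\<And>i j a. i \<in> C \<Longrightarrow> j \<in> I - C \<Longrightarrow> a \<in> {1..3} \<Longrightarrow> gr_cong 1 0 1 (B i j a) (B' i j a)"
  shows "gr_cong 1 0 (card C * (2 + card (I - C) * 3)) (cluster_prod I C A B) (cluster_prod I C A' B')"
proof -
  have "gr_cong 1 0 (card {1..2::nat} * 1 + card (I - C) * (card {1..3::nat} * 1))
      ((\<Prod>s\<in>{1..2}. A i s) * (\<Prod>j\<in>I - C. \<Prod>a\<in>{1..3}. B i j a))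
      ((\<Prod>s\<in>{1..2}. A' i s) * (\<Prod>j\<in>I - C. \<Prod>a\<in>{1..3}. B' i j a))" if "i \<in> C" for i
    using assms that by (intro gr_cong_mult gr_cong_prod one)
  then show ?thesis
    unfolding cluster_prod_def by (intro gr_cong_prod one) simp
qed

text \<open>
  On the solution set both sides of the equation of \<open>C\<close> agree, and both have the same leading form
  \<open>T\<close> up to the factor \<open>p ^ card C\<close>. Hence \<open>(p ^ card C - 1) * T\<close> has lower degree than its
  declared one, and so does \<open>T\<close>; the exponents two and three in \<open>T\<close> are absorbed by the radical.
\<close>

lemma finite_cluster_solutions:
  fixes I :: "'i set"
  assumes I: "finite I" and k: "k \<in> I" and p: "\<And>c. c > 0 \<Longrightarrow> p ^ c \<noteq> 1"
  shows "finite {u k |u. cluster_system I p \<omega> \<kappa> u}"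
proof (cases "\<exists>u0. cluster_system I p \<omega> \<kappa> u0")
  case False
  then show ?thesis by simp
next
  case True
  then obtain u0 where u0: "cluster_system I p \<omega> \<kappa> u0" by blast
  \<comment> \<open>Composing the coordinates with a retraction onto the solution set turns the equations
    into identities between functions on the whole type.\<close>
  define x :: "'i \<Rightarrow> ('i \<Rightarrow> complex) \<Rightarrow> complex"
    where "x = (\<lambda>i u. if cluster_system I p \<omega> \<kappa> u then u i else u0 i)"
  have sys: "cluster_system I p \<omega> \<kappa> (\<lambda>i. x i u)" for u
    using u0 by (cases "cluster_system I p \<omega> \<kappa> u") (simp_all add: x_def)
  interpret polys: degree_filtration "polys_below I x" by (rule polys_below_filtration)
  have x: "x i \<in> polys_below I x (Suc 1)" if "i \<in> I" for i
    using generator_in_polys_below[OF I that] .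
  have "polys.gr_nilpotent (card C * (1 + card (I - C))) (\<Prod>i\<in>C. x i * (\<Prod>j\<in>I - C. x i - x j))"
    (is "polys.gr_nilpotent ?m ?M") if C: "C \<subseteq> I" "C \<noteq> {}" for C
  proof -
    define T where "T = cluster_prod I C (\<lambda>i s. x i) (\<lambda>i j a. x i - x j)"
    define num where "num = cluster_prod I C (\<lambda>i s. x i - (\<lambda>_. \<omega> s)) (\<lambda>i j a. x i - x j + (\<lambda>_. \<kappa> a))"
    define den where "den = cluster_prod I C (\<lambda>i s. x i - (\<lambda>_. \<omega> s - \<kappa> 2)) (\<lambda>i j a. x i - x j - (\<lambda>_. \<kappa> a))"
    define P where "P = (\<lambda>_::'i \<Rightarrow> complex. p ^ card C)"
    let ?d = "card C * (2 + card (I - C) * 3)"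
    have near: "polys.gr_cong 1 0 1 f g"
      if "g \<in> polys_below I x (Suc 1)" "f - g = (\<lambda>_. c)" for f g c
    proof -
      have fg: "f - g \<in> polys_below I x (Suc d)" for d
        using that(2) const_in_polys_below by simp
      have "f - g + g \<in> polys_below I x (Suc 1)"
        by (intro polys.add fg that)
      moreover have "polys.gr_nilpotent 1 (f - g)"
        using fg[of 1] fg[of 0] by (intro polys.gr_nilpotent_if_lower_degree) auto
      ultimately show ?thesis
        using that(1) polys.one by (simp add: polys.gr_cong_def)
    qed
    have num: "polys.gr_cong 1 0 ?d num T"
      unfolding num_def T_def
    proof (intro polys.gr_cong_cluster_prod)
      show "polys.gr_cong 1 0 1 (x i - (\<lambda>_. \<omega> s)) (x i)" if "i \<in> C" for i s
        using that C by (intro near[of _ _ "- \<omega> s"] x) (auto simp: fun_eq_iff)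
      show "polys.gr_cong 1 0 1 (x i - x j + (\<lambda>_. \<kappa> a)) (x i - x j)" if "i \<in> C" "j \<in> I - C" for i j a
        using that C by (intro near[of _ _ "\<kappa> a"] polys.diff x) (auto simp: fun_eq_iff)
    qed
    have den: "polys.gr_cong 1 0 ?d den T"
      unfolding den_def T_def
    proof (intro polys.gr_cong_cluster_prod)
      show "polys.gr_cong 1 0 1 (x i - (\<lambda>_. \<omega> s - \<kappa> 2)) (x i)" if "i \<in> C" for i s
        using that C by (intro near[of _ _ "- (\<omega> s - \<kappa> 2)"] x) (auto simp: fun_eq_iff)
      show "polys.gr_cong 1 0 1 (x i - x j - (\<lambda>_. \<kappa> a)) (x i - x j)" if "i \<in> C" "j \<in> I - C" for i j a
        using that C by (intro near[of _ _ "- \<kappa> a"] polys.diff x) (auto simp: fun_eq_iff)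
    qed
    have eq: "P * num = den"
    proof
      fix u
      have "p ^ card C * cluster_prod I C (\<lambda>i s. x i u - \<omega> s) (\<lambda>i j a. x i u - x j u + \<kappa> a) =
          cluster_prod I C (\<lambda>i s. x i u - \<omega> s + \<kappa> 2) (\<lambda>i j a. x i u - x j u - \<kappa> a)"
        using sys[of u] C(1) unfolding cluster_system_def by blast
      then show "(P * num) u = den u"
        by (simp add: P_def num_def den_def cluster_prod_fun_apply algebra_simps)
    qed
    have "P \<in> polys_below I x (Suc 0)" unfolding P_def by (rule const_in_polys_below)
    then have "polys.gr_nilpotent ?d (P * (num - T))"
      using num polys.gr_nilpotent_mult[of ?d "num - T" P 0] by (simp add: polys.gr_cong_def)
    moreover have "polys.gr_nilpotent ?d (den - T)"
      using den by (simp add: polys.gr_cong_def)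
    ultimately have "polys.gr_nilpotent ?d ((den - T) + - (P * (num - T)))"
      by (intro polys.gr_nilpotent_add polys.gr_nilpotent_minus)
    also have "(den - T) + - (P * (num - T)) = (P - 1) * T"
      unfolding eq[symmetric] by (simp add: algebra_simps)
    finally have PT: "polys.gr_nilpotent ?d ((P - 1) * T)" .
    have fC: "finite C" using C I finite_subset by blast
    with C have "p ^ card C \<noteq> 1" by (intro p) (simp add: card_gt_0_iff)
    then have "(\<lambda>_. 1 / (p ^ card C - 1)) * ((P - 1) * T) = T"
      by (simp add: P_def fun_eq_iff)
    with polys.gr_nilpotent_mult[OF PT const_in_polys_below[of "1 / (p ^ card C - 1)" _ _ 0]]
    have "polys.gr_nilpotent ?d T" by simp
    moreover have "(\<Prod>i\<in>C. x i) \<in> polys_below I x (Suc (card C * 1))"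
      using C x by (intro polys.prod) auto
    ultimately have "polys.gr_nilpotent (?d + card C * 1) ((\<Prod>i\<in>C. x i) * T)"
      by (rule polys.gr_nilpotent_mult)
    \<comment> \<open>The extra factor evens out the exponents two and three.\<close>
    also have "(\<Prod>i\<in>C. x i) * T = ?M ^ 3"
      unfolding T_def cluster_prod_def
      by (simp add: power_mult_distrib power2_eq_square power3_eq_cube prod.distrib mult_ac)
    also have "?d + card C * 1 = 3 * ?m" by (simp add: algebra_simps)
    finally show ?thesis
    proof (rule polys.gr_nilpotent_root)
      have "?M \<in> polys_below I x (Suc (card C * (1 + card (I - C) * 1)))"
        using C by (intro polys.prod polys.mult_Suc polys.diff x) auto
      then show "?M \<in> polys_below I x (Suc ?m)" by simp
    qed simp
  qed
  then have "polys.gr_nilpotent 1 (x i)" if "i \<in> I" for i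
    using polys.gr_nilpotent_generators[of I x i] I x that by blast
  then have "finite (range (x k))"
    by (rule finite_range_generator[OF I _ k])
  moreover have "{u k |u. cluster_system I p \<omega> \<kappa> u} \<subseteq> range (x k)"
    by (force simp: x_def image_iff)
  ultimately show ?thesis by (rule finite_subset[rotated])
qed

section \<open>Cancellation in products of Bethe equations\<close>

text \<open>
  Off-diagonal factors cancel in pairs, and only the diagonal is left.
\<close>

lemma prod_antisymmetric_pairs:
  fixes G :: "'i \<Rightarrow> 'i \<Rightarrow> 'b::comm_ring_1"
  assumes "finite C" and "\<And>i. i \<in> C \<Longrightarrow> G i i = -1"
    and "\<And>i j. i \<in> C \<Longrightarrow> j \<in> C \<Longrightarrow> i \<noteq> j \<Longrightarrow> G i j * G j i = 1"
  shows "(\<Prod>i\<in>C. \<Prod>j\<in>C. G i j) = (-1) ^ card C"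
  using assms
proof (induction C rule: finite_induct)
  case (insert k C)
  have "(\<Prod>i\<in>insert k C. \<Prod>j\<in>insert k C. G i j) =
      G k k * ((\<Prod>i\<in>C. G i k * G k i) * (\<Prod>i\<in>C. \<Prod>j\<in>C. G i j))"
    using insert.hyps by (simp add: prod.distrib mult_ac)
  also have "(\<Prod>i\<in>C. G i k * G k i) = 1"
    using insert by (intro prod.neutral) auto
  finally show ?case using insert by simp
qed simp

text \<open>
  The two-particle factor \<open>G\<close> satisfies \<open>G i j * G j i = (q 1 * q 2 * q 3)\<^sup>2 = 1\<close> and
  \<open>G i i = - (q 1 * q 2 * q 3) = -1\<close>. So the factors internal to \<open>C\<close> multiply to
  \<open>(-1) ^ card C\<close>, which is also the product of the right-hand sides. The cancellation is exact
  because no numerator or denominator vanishes at a solution of the Bethe equations.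
\<close>

lemma bethe_cluster_equation:
  fixes q v t :: "nat \<Rightarrow> complex"
  assumes bethe: "bethe_equations N p (q 1) (q 2) (q 3) v t"
    and q: "q 1 * q 2 * q 3 = 1" and C: "C \<subseteq> {1..N}"
  shows "p ^ card C * cluster_prod {1..N} C (\<lambda>i s. t i - v s) (\<lambda>i j a. q a * t i - t j) =
    cluster_prod {1..N} C (\<lambda>i s. t i - v s / q 2) (\<lambda>i j a. t i / q a - t j)"
proof -
  define G where "G = (\<lambda>i j. \<Prod>a\<in>{1..3}. (q a * t i - t j) / (t i / q a - t j))"
  define D where "D = (\<lambda>i. \<Prod>s\<in>{1..2}. (t i - v s) / (t i - v s / q 2))"
  let ?I = "{1..N}"
  have three: "(\<Prod>a\<in>{1..3}. f a) = f 1 * f 2 * f 3" for f :: "nat \<Rightarrow> complex"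
    by (simp add: numeral_3_eq_3 numeral_2_eq_2)
  have q0: "q a \<noteq> 0" if "a \<in> {1..3}" for a
  proof -
    have "a = 1 \<or> a = 2 \<or> a = 3" using that by auto
    then show ?thesis using q by auto
  qed
  have main: "p * D i * (\<Prod>j\<in>?I. G i j) = -1" if "i \<in> ?I" for i
    using bethe that unfolding bethe_equations_def D_def G_def three
    by (simp add: divide_inverse mult_ac)
  have nz: "G i j \<noteq> 0" if "i \<in> ?I" "j \<in> ?I" for i j
  proof
    assume "G i j = 0"
    with that have "(\<Prod>j\<in>?I. G i j) = 0" by (intro prod_zero) auto
    with main[OF that(1)] show False by (metis mult_zero_right zero_neq_neg_one)
  qed
  have Gnz: "q a * t i - t j \<noteq> 0" "t i / q a - t j \<noteq> 0" if "i \<in> ?I" "j \<in> ?I" "a \<in> {1..3}" for i j a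
    using nz[OF that(1,2)] that(3) unfolding G_def by (auto simp: prod_zero_iff)
  have Gii: "G i i = -1" if i: "i \<in> ?I" for i
  proof -
    have "(q a * t i - t i) / (t i / q a - t i) = - q a" if a: "a \<in> {1..3}" for a
      using Gnz(2)[OF i i a] q0[OF a] by (simp add: field_simps)
    then have "G i i = (\<Prod>a\<in>{1..3}. - q a)"
      unfolding G_def by (intro prod.cong) auto
    then show ?thesis using q unfolding three by simp
  qed
  have Gij: "G i j * G j i = 1" if ij: "i \<in> ?I" "j \<in> ?I" for i j
  proof -
    have "(q a * t i - t j) / (t i / q a - t j) * ((q a * t j - t i) / (t j / q a - t i)) = q a * q a"
      if a: "a \<in> {1..3}" for a
    proof -
      have swap: "t j / q a - t i = - (q a * t i - t j) / q a"
          "q a * t j - t i = - (t i / q a - t j) * q a"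
        using q0[OF a] by (simp_all add: field_simps)
      have "A / B * (- B * c / (- A / c)) = c * c" if "A \<noteq> 0" "B \<noteq> 0" "c \<noteq> 0"
        for A B c :: complex
        using that by simp
      from this[OF Gnz[OF ij a] q0[OF a]] show ?thesis unfolding swap .
    qed
    then have "G i j * G j i = (\<Prod>a\<in>{1..3}. q a * q a)"
      unfolding G_def prod.distrib[symmetric] by (intro prod.cong) auto
    also have "\<dots> = (q 1 * q 2 * q 3) * (q 1 * q 2 * q 3)"
      unfolding three by (simp add: mult_ac)
    finally show ?thesis using q by simp
  qed
  have fC: "finite C" using C finite_subset by blast
  have "(-1) ^ card C = (\<Prod>i\<in>C. p * D i * (\<Prod>j\<in>?I. G i j))"
    using main C by (simp add: subset_iff)
  also have "\<dots> = (\<Prod>i\<in>C. p * D i * ((\<Prod>j\<in>?I - C. G i j) * (\<Prod>j\<in>C. G i j)))"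
    using C by (intro prod.cong arg_cong2[of _ _ _ _ "(*)"] refl prod.subset_diff) auto
  also have "\<dots> = p ^ card C * (\<Prod>i\<in>C. D i * (\<Prod>j\<in>?I - C. G i j)) * (\<Prod>i\<in>C. \<Prod>j\<in>C. G i j)"
    by (simp add: prod.distrib mult_ac)
  also have "(\<Prod>i\<in>C. \<Prod>j\<in>C. G i j) = (-1) ^ card C"
    by (rule prod_antisymmetric_pairs) (use Gii Gij C fC in blast)+
  finally have one: "p ^ card C * (\<Prod>i\<in>C. D i * (\<Prod>j\<in>?I - C. G i j)) = 1" by simp
  have quot: "(\<Prod>i\<in>C. D i * (\<Prod>j\<in>?I - C. G i j)) =
      cluster_prod ?I C (\<lambda>i s. t i - v s) (\<lambda>i j a. q a * t i - t j) /
      cluster_prod ?I C (\<lambda>i s. t i - v s / q 2) (\<lambda>i j a. t i / q a - t j)"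
    unfolding cluster_prod_def D_def G_def by (simp add: prod_dividef prod.distrib)
  have "P * a = b" if "P * X = 1" "X = a / b" for P X a b :: complex
    using that by (cases "b = 0") (auto simp: field_simps)
  from this[OF one quot] show ?thesis .
qed

section \<open>Limits of the cluster equations\<close>

text \<open>
  The scale \<open>\<rho>\<close> is left open: it will be \<open>\<epsilon>\<close> itself in the final limit, and the size of \<open>t - 1\<close>
  in the proof that this size is of order \<open>\<epsilon>\<close>. Large \<open>\<rho>\<close> is harmless, since
  \<open>(q * t i - t j) / \<rho>\<close> equals
  \<open>(t i - 1) / \<rho> - (t j - 1) / \<rho> + (q - 1) / \<rho> + (q - 1) * ((t i - 1) / \<rho>)\<close> and
  \<open>q\<close> tends to \<open>1\<close>.
\<close>

lemma cluster_system_limit: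
  fixes t v q :: "nat \<Rightarrow> 'e \<Rightarrow> complex" and \<rho> :: "'e \<Rightarrow> complex"
  assumes F: "F \<noteq> bot" and \<rho>: "\<forall>\<^sub>F e in F. \<rho> e \<noteq> 0"
    and t: "\<And>i. i \<in> {1..N} \<Longrightarrow> ((\<lambda>e. (t i e - 1) / \<rho> e) \<longlongrightarrow> x i) F"
    and v: "\<And>s. s \<in> {1..2} \<Longrightarrow> ((\<lambda>e. (v s e - 1) / \<rho> e) \<longlongrightarrow> \<omega> s) F"
    and q: "\<And>a. a \<in> {1..3} \<Longrightarrow> ((\<lambda>e. (q a e - 1) / \<rho> e) \<longlongrightarrow> \<kappa> a) F"
    and q1: "\<And>a. a \<in> {1..3} \<Longrightarrow> (q a \<longlongrightarrow> 1) F"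
    and qprod: "\<forall>\<^sub>F e in F. q 1 e * q 2 e * q 3 e = 1"
    and bethe: "\<forall>\<^sub>F e in F. bethe_equations N p (q 1 e) (q 2 e) (q 3 e) (\<lambda>s. v s e) (\<lambda>i. t i e)"
  shows "cluster_system {1..N} p \<omega> \<kappa> x"
  unfolding cluster_system_def
proof (intro allI impI)
  fix C assume C: "C \<subseteq> {1..N}"
  let ?cp = "cluster_prod {1..N} C"
  define y where "y = (\<lambda>i e. (t i e - 1) / \<rho> e)"
  define \<nu> where "\<nu> = (\<lambda>s e. (v s e - 1) / \<rho> e)"
  define k where "k = (\<lambda>a e. (q a e - 1) / \<rho> e)"
  define num where "num = (\<lambda>e. ?cp (\<lambda>i s. y i e - \<nu> s e)
    (\<lambda>i j a. y i e - y j e + k a e + (q a e - 1) * y i e))"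
  define den where "den = (\<lambda>e. ?cp (\<lambda>i s. y i e - \<nu> s e / q 2 e + k 2 e / q 2 e)
    (\<lambda>i j a. y i e / q a e - y j e - k a e / q a e))"
  have lims: "\<And>i. i \<in> {1..N} \<Longrightarrow> (y i \<longlongrightarrow> x i) F" "\<And>s. s \<in> {1..2} \<Longrightarrow> (\<nu> s \<longlongrightarrow> \<omega> s) F"
    "\<And>a. a \<in> {1..3} \<Longrightarrow> (k a \<longlongrightarrow> \<kappa> a) F"
    using t v q by (simp_all add: y_def \<nu>_def k_def)
  have num_lim: "(num \<longlongrightarrow> ?cp (\<lambda>i s. x i - \<omega> s) (\<lambda>i j a. x i - x j + \<kappa> a + (1 - 1) * x i)) F"
    unfolding num_def using C
    by (intro tendsto_cluster_prod tendsto_intros lims q1) auto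
  have den_lim: "(den \<longlongrightarrow> ?cp (\<lambda>i s. x i - \<omega> s / 1 + \<kappa> 2 / 1) (\<lambda>i j a. x i / 1 - x j - \<kappa> a / 1)) F"
    unfolding den_def using C
    by (intro tendsto_cluster_prod tendsto_intros lims q1) auto
  have eq: "\<forall>\<^sub>F e in F. p ^ card C * num e = den e"
    using \<rho> qprod bethe
  proof eventually_elim
    case (elim e)
    have q0: "q a e \<noteq> 0" if "a \<in> {1..3}" for a
    proof -
      have "a = 1 \<or> a = 2 \<or> a = 3" using that by auto
      then show ?thesis using elim(2) by auto
    qed
    let ?r = "\<rho> e ^ (card C * (2 + card ({1..N} - C) * 3))"
    have "?cp (\<lambda>i s. t i e - v s e) (\<lambda>i j a. q a e * t i e - t j e) = ?r * num e"
      unfolding num_def cluster_prod_scale[symmetric]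
      by (rule cluster_prod_cong)
        (use elim(1) in \<open>simp_all add: y_def \<nu>_def k_def field_simps\<close>)
    moreover have "?cp (\<lambda>i s. t i e - v s e / q 2 e) (\<lambda>i j a. t i e / q a e - t j e) = ?r * den e"
      unfolding den_def cluster_prod_scale[symmetric]
      by (rule cluster_prod_cong)
        (use elim(1) q0 q0[of 2] in \<open>simp_all add: y_def \<nu>_def k_def field_simps\<close>)
    ultimately have "p ^ card C * (?r * num e) = ?r * den e"
      using bethe_cluster_equation[where q = "\<lambda>a. q a e", OF elim(3,2) C] by simp
    then have "?r * (p ^ card C * num e) = ?r * den e" by (simp only: mult_ac)
    then show ?case using elim(1) by simp
  qed
  have "((\<lambda>e. p ^ card C * num e) \<longlongrightarrow> p ^ card C * ?cp (\<lambda>i s. x i - \<omega> s) (\<lambda>i j a. x i - x j + \<kappa> a)) F"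
    using num_lim by (intro tendsto_intros) simp
  moreover have "((\<lambda>e. p ^ card C * num e) \<longlongrightarrow> ?cp (\<lambda>i s. x i - \<omega> s + \<kappa> 2) (\<lambda>i j a. x i - x j - \<kappa> a)) F"
    using den_lim by (subst tendsto_cong[OF eq]) simp
  ultimately show "p ^ card C * ?cp (\<lambda>i s. x i - \<omega> s) (\<lambda>i j a. x i - x j + \<kappa> a) =
      ?cp (\<lambda>i s. x i - \<omega> s + \<kappa> 2) (\<lambda>i j a. x i - x j - \<kappa> a)"
    using F tendsto_unique by blast
qed

text \<open>
  The leading forms have no common zero except the origin: the equation of the set of indices at
  which \<open>x\<close> takes the same nonzero value has no vanishing factor.
\<close>

lemma cluster_system_homogeneous_imp_zero:
  assumes I: "finite I" and p: "\<And>c. c > 0 \<Longrightarrow> p ^ c \<noteq> 1"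
    and sys: "cluster_system I p (\<lambda>_. 0) (\<lambda>_. 0) x" and k: "k \<in> I"
  shows "x k = 0"
proof (rule ccontr)
  assume xk: "x k \<noteq> 0"
  define C where "C = {i \<in> I. x i = x k}"
  let ?T = "cluster_prod I C (\<lambda>i s. x i) (\<lambda>i j a. x i - x j)"
  have C: "C \<subseteq> I" "finite C" "k \<in> C" using I k by (auto simp: C_def)
  then have "p ^ card C \<noteq> 1" by (intro p) (auto simp: card_gt_0_iff)
  moreover have "p ^ card C * ?T = ?T"
    using sys C(1) by (auto simp: cluster_system_def)
  ultimately have "?T = 0" by simp
  then show False
    using xk C I by (auto simp: cluster_prod_def C_def prod_zero_iff)
qed

text \<open>
  Refining a filter replaces the extraction of a subsequence, and restricting it to the places where
  a bound is violated needs no choice of points.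
\<close>

lemma convergent_subfilter:
  fixes f :: "'i \<Rightarrow> 'e \<Rightarrow> 'a::topological_space"
  assumes "finite I" "F \<noteq> bot" "compact S" "\<And>i. i \<in> I \<Longrightarrow> \<forall>\<^sub>F e in F. f i e \<in> S"
  obtains F' x where "F' \<le> F" "F' \<noteq> bot" "\<And>i. i \<in> I \<Longrightarrow> (f i \<longlongrightarrow> x i) F'"
proof -
  have "\<exists>F' x. F' \<le> F \<and> F' \<noteq> bot \<and> (\<forall>i\<in>I. (f i \<longlongrightarrow> x i) F')"
    using assms(1,4)
  proof (induction I rule: finite_induct)
    case empty
    then show ?case using assms(2) by auto
  next
    case (insert k I)
    then obtain G x where G: "G \<le> F" "G \<noteq> bot" "\<forall>i\<in>I. (f i \<longlongrightarrow> x i) G" by auto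
    have "filtermap (f k) G \<noteq> bot" using G(2) by (simp add: filtermap_bot_iff)
    moreover have "\<forall>\<^sub>F y in filtermap (f k) G. y \<in> S"
      using insert.prems G(1) by (simp add: eventually_filtermap filter_leD)
    ultimately obtain z where z: "inf (nhds z) (filtermap (f k) G) \<noteq> bot"
      using assms(3) unfolding compact_filter by blast
    define G' where "G' = inf G (filtercomap (f k) (nhds z))"
    have "G' \<noteq> bot"
    proof
      assume "G' = bot"
      then have "eventually (\<lambda>_. False) G'" by simp
      then obtain P Q where PQ: "eventually P G" "eventually Q (filtercomap (f k) (nhds z))"
        "\<And>e. P e \<Longrightarrow> Q e \<Longrightarrow> False"
        unfolding G'_def eventually_inf by blast
      then obtain U where U: "eventually U (nhds z)" "\<And>e. U (f k e) \<Longrightarrow> Q e"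
        unfolding eventually_filtercomap by blast
      have "\<forall>\<^sub>F y in filtermap (f k) G. \<not> U y"
        using PQ(1) unfolding eventually_filtermap by eventually_elim (use PQ(3) U(2) in blast)
      then have "eventually (\<lambda>_. False) (inf (nhds z) (filtermap (f k) G))"
        unfolding eventually_inf using U(1) by blast
      with z show False by (simp add: trivial_limit_def)
    qed
    moreover have "(f k \<longlongrightarrow> z) G'"
      unfolding G'_def by (metis filterlim_filtercomap filterlim_mono inf_le2 order_refl)
    moreover have "G' \<le> G" by (simp add: G'_def)
    ultimately show ?case
      using G insert.hyps
      by (intro exI[of _ G'] exI[of _ "x(k := z)"]) (auto intro: tendsto_mono)
  qed
  then show ?thesis using that by blast
qed

text \<open>
  Otherwise the total size \<open>R\<close> of \<open>t - 1\<close> dominates \<open>h\<close> along a finer filter. Relative to the scale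
  \<open>R\<close> the first-order data of \<open>v\<close> and \<open>q\<close> disappear, while \<open>(t - 1) / R\<close> has norm one. Its cluster
  points would be nonzero common zeros of the leading forms.
\<close>

lemma bethe_solutions_bounded:
  fixes t v q :: "nat \<Rightarrow> 'e \<Rightarrow> complex" and h :: "'e \<Rightarrow> complex"
  assumes h: "\<forall>\<^sub>F e in F. h e \<noteq> 0"
    and p: "\<And>c. c > 0 \<Longrightarrow> p ^ c \<noteq> 1"
    and v: "\<And>s. s \<in> {1..2} \<Longrightarrow> ((\<lambda>e. (v s e - 1) / h e) \<longlongrightarrow> \<omega> s) F"
    and q: "\<And>a. a \<in> {1..3} \<Longrightarrow> ((\<lambda>e. (q a e - 1) / h e) \<longlongrightarrow> \<kappa> a) F"
    and q1: "\<And>a. a \<in> {1..3} \<Longrightarrow> (q a \<longlongrightarrow> 1) F"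
    and qprod: "\<forall>\<^sub>F e in F. q 1 e * q 2 e * q 3 e = 1"
    and bethe: "\<forall>\<^sub>F e in F. bethe_equations N p (q 1 e) (q 2 e) (q 3 e) (\<lambda>s. v s e) (\<lambda>i. t i e)"
  shows "\<exists>K. \<forall>\<^sub>F e in F. \<forall>i\<in>{1..N}. norm ((t i e - 1) / h e) \<le> K"
proof (rule ccontr)
  assume unbounded: "\<not> ?thesis"
  define R where "R = (\<lambda>e. \<Sum>i\<in>{1..N}. norm (t i e - 1))"
  define F' where "F' = inf F (filtercomap (\<lambda>e. R e / norm (h e)) at_top)"
  have le: "norm (t i e - 1) \<le> R e" if "i \<in> {1..N}" for i e
    unfolding R_def using that by (intro member_le_sum) auto
  have "F' \<noteq> bot"
  proof
    assume "F' = bot"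
    then have "eventually (\<lambda>_. False) F'" by simp
    then obtain P Q where PQ: "eventually P F" "\<And>e. P e \<Longrightarrow> Q e \<Longrightarrow> False"
      "eventually Q (filtercomap (\<lambda>e. R e / norm (h e)) at_top)"
      unfolding F'_def eventually_inf by blast
    then obtain K where K: "\<And>e. R e / norm (h e) \<ge> K \<Longrightarrow> Q e"
      unfolding eventually_filtercomap_at_top_linorder by blast
    have "\<forall>\<^sub>F e in F. \<forall>i\<in>{1..N}. norm ((t i e - 1) / h e) \<le> K"
      using PQ(1)
    proof (eventually_elim, intro ballI)
      fix e i assume "P e" "i \<in> {1..N}"
      then have "R e / norm (h e) \<le> K" using PQ(2) K by force
      moreover have "norm ((t i e - 1) / h e) \<le> R e / norm (h e)"
        using le[OF \<open>i \<in> {1..N}\<close>] by (simp add: norm_divide divide_right_mono)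
      ultimately show "norm ((t i e - 1) / h e) \<le> K" by simp
    qed
    with unbounded show False by blast
  qed
  have le_F: "F' \<le> F" and lim: "filterlim (\<lambda>e. R e / norm (h e)) at_top F'"
    unfolding F'_def by (simp, metis filterlim_filtercomap filterlim_mono inf_le2 order_refl)
  have R0: "\<forall>\<^sub>F e in F'. R e \<noteq> 0"
    using lim[unfolded filterlim_at_top, rule_format, of 1] by eventually_elim auto
  have hR: "((\<lambda>e. h e / of_real (R e)) \<longlongrightarrow> 0) F'"
  proof (rule tendsto_norm_zero_cancel)
    have "((\<lambda>e. inverse (R e / norm (h e))) \<longlongrightarrow> 0) F'"
      using lim by (rule tendsto_inverse_0_at_top)
    moreover have "inverse (R e / norm (h e)) = norm (h e / of_real (R e))" for e
    proof -
      have "R e \<ge> 0" by (simp add: R_def sum_nonneg)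
      then show ?thesis by (simp add: norm_divide)
    qed
    ultimately show "((\<lambda>e. norm (h e / of_real (R e))) \<longlongrightarrow> 0) F'" by simp
  qed
  have rescale: "((\<lambda>e. f e / of_real (R e)) \<longlongrightarrow> 0) G"
    if "((\<lambda>e. f e / h e) \<longlongrightarrow> c) F" "G \<le> F'" for f :: "'e \<Rightarrow> complex" and c G
  proof -
    have G: "G \<le> F" using that(2) le_F by simp
    have "((\<lambda>e. f e / h e * (h e / of_real (R e))) \<longlongrightarrow> c * 0) G"
      using tendsto_mono[OF G that(1)] tendsto_mono[OF that(2) hR] by (rule tendsto_mult)
    moreover have "\<forall>\<^sub>F e in G. f e / h e * (h e / of_real (R e)) = f e / of_real (R e)"
      using filter_leD[OF G h] by eventually_elim simp
    ultimately have "((\<lambda>e. f e / of_real (R e)) \<longlongrightarrow> c * 0) G"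
      by (rule Lim_transform_eventually)
    then show ?thesis by simp
  qed
  define y where "y = (\<lambda>i e. (t i e - 1) / of_real (R e))"
  have "\<forall>\<^sub>F e in F'. y i e \<in> cball 0 1" if "i \<in> {1..N}" for i
    using R0
  proof eventually_elim
    case (elim e)
    have "R e \<ge> 0" by (simp add: R_def sum_nonneg)
    then show ?case
      using le[OF that, of e] elim by (simp add: y_def norm_divide divide_le_eq)
  qed
  then obtain G x where G: "G \<le> F'" "G \<noteq> bot" and x: "\<And>i. i \<in> {1..N} \<Longrightarrow> (y i \<longlongrightarrow> x i) G"
    using convergent_subfilter[of "{1..N}" F' "cball 0 1" y] \<open>F' \<noteq> bot\<close> by auto
  have GF: "G \<le> F" using G(1) le_F by simp
  have "cluster_system {1..N} p (\<lambda>_. 0) (\<lambda>_. 0) x"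
  proof (rule cluster_system_limit[where t = t and v = v and q = q and \<rho> = "\<lambda>e. of_real (R e)"])
    show "\<forall>\<^sub>F e in G. complex_of_real (R e) \<noteq> 0"
      using filter_leD[OF G(1) R0] by eventually_elim simp
  qed (use x[unfolded y_def] rescale[OF v G(1)] rescale[OF q G(1)] tendsto_mono[OF GF q1]
        filter_leD[OF GF qprod] filter_leD[OF GF bethe] G(2) in auto)
  then have "x i = 0" if "i \<in> {1..N}" for i
    using cluster_system_homogeneous_imp_zero[of "{1..N}" p x i] p that by simp
  then have "((\<lambda>e. \<Sum>i\<in>{1..N}. norm (y i e)) \<longlongrightarrow> (\<Sum>i\<in>{1..N}. 0)) G"
    using x by (intro tendsto_sum tendsto_norm_zero) auto
  moreover have "\<forall>\<^sub>F e in G. (\<Sum>i\<in>{1..N}. norm (y i e)) = 1"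
    using filter_leD[OF G(1) R0]
  proof eventually_elim
    case (elim e)
    have "R e \<ge> 0" by (simp add: R_def sum_nonneg)
    then have "(\<Sum>i\<in>{1..N}. norm (y i e)) = (\<Sum>i\<in>{1..N}. norm (t i e - 1) / R e)"
      by (simp add: y_def norm_divide)
    also have "\<dots> = R e / R e"
      unfolding sum_divide_distrib[symmetric] by (simp add: R_def)
    finally show ?case using elim by simp
  qed
  ultimately have "((\<lambda>e. 1::real) \<longlongrightarrow> (\<Sum>i\<in>{1..N}. 0)) G"
    by (rule Lim_transform_eventually)
  then show False using G(2) by (simp add: tendsto_const_iff)
qed

section \<open>Convergence from finitely many cluster points\<close>

text \<open>
  Disjoint balls around the finitely many candidates eventually cover the values of \<open>g\<close>; by
  connectedness a single ball does, so that the values cannot switch between candidates.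
\<close>

lemma tendsto_if_cluster_points_finite:
  fixes g :: "real \<Rightarrow> 'a::metric_space"
  assumes Z: "finite Z" and nonbot: "at 0 within E \<noteq> bot"
    and conn: "\<And>\<eta>. \<eta> > 0 \<Longrightarrow> connected (E \<inter> ball 0 \<eta>)" and "0 \<notin> E"
    and cont: "continuous_on E g"
    and near: "\<And>U. open U \<Longrightarrow> Z \<subseteq> U \<Longrightarrow> \<forall>\<^sub>F e in at 0 within E. g e \<in> U"
  shows "\<exists>z. (g \<longlongrightarrow> z) (at 0 within E)"
proof -
  have "\<forall>z\<in>Z. \<exists>r>0. \<forall>z'\<in>Z. z' \<noteq> z \<longrightarrow> r \<le> dist z z'"
    using finite_set_avoid[OF Z] by blast
  then obtain f where f: "\<And>z. z \<in> Z \<Longrightarrow> f z > 0"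
    "\<And>z z'. z \<in> Z \<Longrightarrow> z' \<in> Z \<Longrightarrow> z' \<noteq> z \<Longrightarrow> f z \<le> dist z z'"
    by metis
  define r where "r = Min (insert 1 (f ` Z))"
  have r: "r > 0" unfolding r_def using Z f(1) by (subst Min_gr_iff) auto
  have sep: "z = z'" if "z \<in> Z" "z' \<in> Z" "dist z a < r / 2" "dist z' a < r / 2" for z z' a
  proof (rule ccontr)
    assume "z \<noteq> z'"
    then have "r \<le> dist z z'"
      using f(2)[of z z'] that Z by (auto simp: r_def intro: order.trans[OF Min_le])
    with dist_triangle_half_r[of a z r z'] that show False by (simp add: dist_commute)
  qed
  let ?B = "\<lambda>A. \<Union>z\<in>A. ball z (r / 2)"
  have "\<forall>\<^sub>F e in at 0 within E. g e \<in> ?B Z"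
    using r by (intro near) (auto intro!: bexI)
  then obtain \<eta> where \<eta>: "\<eta> > 0" "\<And>e. e \<in> E \<Longrightarrow> e \<noteq> 0 \<Longrightarrow> dist e 0 < \<eta> \<Longrightarrow> g e \<in> ?B Z"
    unfolding eventually_at by blast
  define J where "J = E \<inter> ball 0 \<eta>"
  have J: "\<forall>\<^sub>F e in at 0 within E. e \<in> J"
    unfolding J_def eventually_at using \<eta>(1) by (auto simp: dist_commute)
  have gJ: "g e \<in> ?B Z" if "e \<in> J" for e
    using that \<eta>(2)[of e] \<open>0 \<notin> E\<close> by (auto simp: J_def dist_commute)
  obtain e0 where e0: "e0 \<in> J"
    using eventually_happens[OF J] nonbot by (auto simp: trivial_limit_def)
  then obtain z0 where z0: "z0 \<in> Z" "dist z0 (g e0) < r / 2" using gJ by auto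
  have "connected (g ` J)"
    using conn[OF \<eta>(1)] cont unfolding J_def
    by (intro connected_continuous_image) (auto intro: continuous_on_subset)
  then have "ball z0 (r / 2) \<inter> g ` J = {} \<or> ?B (Z - {z0}) \<inter> g ` J = {}"
  proof (rule connectedD)
    show "ball z0 (r / 2) \<inter> ?B (Z - {z0}) \<inter> g ` J = {}"
    proof -
      have False if "z \<in> Z - {z0}" "a \<in> ball z0 (r / 2)" "a \<in> ball z (r / 2)" for z a
        using sep[of z z0 a] that z0(1) by simp
      then show ?thesis by blast
    qed
    have "?B Z \<subseteq> ball z0 (r / 2) \<union> ?B (Z - {z0})" by blast
    then show "g ` J \<subseteq> ball z0 (r / 2) \<union> ?B (Z - {z0})" using gJ by blast
  qed auto
  moreover have "g e0 \<in> ball z0 (r / 2) \<inter> g ` J" using e0 z0 by auto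
  ultimately have inter: "?B (Z - {z0}) \<inter> g ` J = {}" by blast
  have in0: "dist z0 (g e) < r / 2" if "e \<in> J" for e
  proof (rule ccontr)
    assume "\<not> dist z0 (g e) < r / 2"
    with gJ[OF that] have "g e \<in> ?B (Z - {z0})" by auto
    with inter that show False by blast
  qed
  have "(g \<longlongrightarrow> z0) (at 0 within E)"
  proof (rule tendstoI)
    fix d :: real assume d: "d > 0"
    have "\<forall>\<^sub>F e in at 0 within E. g e \<in> (\<Union>z\<in>Z. ball z (min d (r / 2)))"
      using r d by (intro near) (auto intro!: bexI)
    then show "\<forall>\<^sub>F e in at 0 within E. dist (g e) z0 < d"
      using J
    proof eventually_elim
      case (elim e)
      then obtain z where z: "z \<in> Z" "dist z (g e) < d" "dist z (g e) < r / 2" by auto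
      with sep[of z z0 "g e"] in0[OF elim(2)] z0 show ?case by (simp add: dist_commute)
    qed
  qed
  then show ?thesis ..
qed

section \<open>The intermediate long wave limit\<close>

lemma at_0_within_one_sided_interval:
  fixes E :: "real set"
  assumes "\<delta> > 0" "E = {0<..<\<delta>} \<or> E = {-\<delta><..<0}"
  shows "at 0 within E \<noteq> bot" "0 \<notin> E" "connected (E \<inter> ball 0 \<eta>)"
proof -
  show "at 0 within E \<noteq> bot"
    using assms by (auto simp: at_within_eq_bot_iff islimpt_conv_frequently_at)
  show "0 \<notin> E" using assms(2) by auto
  have "convex E" using assms(2) by (auto intro: convex_real_interval)
  then show "connected (E \<inter> ball 0 \<eta>)"
    by (intro convex_connected convex_Int) auto
qed

lemma has_linear_approximation_iff:
  fixes f :: "real \<Rightarrow> complex"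
  shows "(\<lambda>\<epsilon>. f \<epsilon> - (1 + c * of_real \<epsilon>)) \<in> o[at 0 within E](\<lambda>\<epsilon>. of_real \<epsilon>) \<longleftrightarrow>
    ((\<lambda>\<epsilon>. (f \<epsilon> - 1) / of_real \<epsilon>) \<longlongrightarrow> c) (at 0 within E)" (is "?L \<longleftrightarrow> ?R")
proof -
  have nz: "\<forall>\<^sub>F \<epsilon> in at 0 within E. complex_of_real \<epsilon> \<noteq> 0"
    unfolding eventually_at by (auto intro: exI[of _ 1])
  have "?L \<longleftrightarrow> ((\<lambda>\<epsilon>. (f \<epsilon> - (1 + c * of_real \<epsilon>)) / of_real \<epsilon>) \<longlongrightarrow> 0) (at 0 within E)"
    by (rule iffI, erule smalloD_tendsto, erule smalloI_tendsto[OF _ nz])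
  also have "\<dots> \<longleftrightarrow> ((\<lambda>\<epsilon>. (f \<epsilon> - 1) / of_real \<epsilon> - c) \<longlongrightarrow> 0) (at 0 within E)"
    by (intro tendsto_cong, use nz in eventually_elim) (simp add: field_simps)
  also have "\<dots> \<longleftrightarrow> ?R" by (rule Lim_null[symmetric])
  finally show ?thesis .
qed

theorem proposition6p2:
  fixes N :: nat and r \<tau> \<delta> :: real and E :: "real set"
    and v t :: "nat \<Rightarrow> real \<Rightarrow> complex" and w :: "nat \<Rightarrow> complex"
  assumes "\<tau> \<noteq> 0"
    and "\<delta> > 0"
    and "E = {0<..<\<delta>} \<or> E = {-\<delta><..<0}"
    and "\<And>s. s \<in> {1..2} \<Longrightarrow>
      (\<lambda>\<epsilon>. v s \<epsilon> - (1 + w s * of_real \<epsilon>)) \<in> o[at 0 within E](\<lambda>\<epsilon>. of_real \<epsilon>)"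
    and "\<And>i. i \<in> {1..N} \<Longrightarrow> continuous_on E (t i)"
    and "\<And>\<epsilon>. \<epsilon> \<in> E \<Longrightarrow>
      bethe_equations N (exp (2 * of_real \<tau>))
        (exp (- (of_real r - 1) * of_real \<epsilon>)) (exp (- of_real \<epsilon>)) (exp (of_real r * of_real \<epsilon>))
        (\<lambda>s. v s \<epsilon>) (\<lambda>i. t i \<epsilon>)"
  shows "\<exists>u :: nat \<Rightarrow> complex.
    (\<forall>i\<in>{1..N}.
      (\<lambda>\<epsilon>. t i \<epsilon> - (1 + u i * of_real \<epsilon>)) \<in> o[at 0 within E](\<lambda>\<epsilon>. of_real \<epsilon>)) \<and>
    (\<forall>i\<in>{1..N}.
      ilw_num N r \<tau> w u i = - ilw_den N r w u i \<and>
      (ilw_den N r w u i \<noteq> 0 \<longrightarrow> ilw_lhs N r \<tau> w u i = -1))"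
proof -
  note E = at_0_within_one_sided_interval[OF assms(2,3)]
  let ?F = "at 0 within E"
  define p :: complex where "p = exp (2 * of_real \<tau>)"
  define \<kappa> :: "nat \<Rightarrow> complex"
    where "\<kappa> = (\<lambda>a. if a = 1 then 1 - of_real r else if a = 2 then -1 else of_real r)"
  define q :: "nat \<Rightarrow> real \<Rightarrow> complex" where "q = (\<lambda>a \<epsilon>. exp (\<kappa> a * of_real \<epsilon>))"
  define y where "y = (\<lambda>i (\<epsilon>::real). (t i \<epsilon> - 1) / of_real \<epsilon>)"
  have p: "p ^ c \<noteq> 1" if "c > 0" for c
  proof
    assume "p ^ c = 1"
    moreover have "p ^ c = of_real (exp (of_nat c * (2 * \<tau>)))"
      by (simp add: p_def exp_of_nat_mult flip: exp_of_real)
    ultimately show False using assms(1) that by (simp only: of_real_eq_1_iff) simp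
  qed
  have nz: "\<forall>\<^sub>F \<epsilon> in ?F. complex_of_real \<epsilon> \<noteq> 0"
    unfolding eventually_at by (auto intro: exI[of _ 1])
  have v: "((\<lambda>\<epsilon>. (v s \<epsilon> - 1) / of_real \<epsilon>) \<longlongrightarrow> w s) ?F" if "s \<in> {1..2}" for s
    using assms(4)[OF that] unfolding has_linear_approximation_iff .
  have q: "((\<lambda>\<epsilon>. (q a \<epsilon> - 1) / of_real \<epsilon>) \<longlongrightarrow> \<kappa> a) ?F" for a
  proof -
    have "((\<lambda>z. exp (\<kappa> a * z)) has_field_derivative \<kappa> a) (at 0)"
      by (auto intro!: derivative_eq_intros)
    then have "((\<lambda>z. (exp (\<kappa> a * z) - 1) / z) \<longlongrightarrow> \<kappa> a) (at 0)"
      by (simp add: has_field_derivative_iff)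
    moreover have "filterlim complex_of_real (at 0) ?F"
      using nz by (auto simp: filterlim_at intro!: tendsto_eq_intros)
    ultimately show ?thesis
      unfolding q_def by (rule filterlim_compose)
  qed
  have q1: "(q a \<longlongrightarrow> 1) ?F" for a
    unfolding q_def by (auto intro!: tendsto_eq_intros)
  have qprod: "\<forall>\<^sub>F \<epsilon> in ?F. q 1 \<epsilon> * q 2 \<epsilon> * q 3 \<epsilon> = 1"
    by (simp add: q_def \<kappa>_def algebra_simps flip: exp_add)
  have bethe: "\<forall>\<^sub>F \<epsilon> in ?F. bethe_equations N p (q 1 \<epsilon>) (q 2 \<epsilon>) (q 3 \<epsilon>) (\<lambda>s. v s \<epsilon>) (\<lambda>i. t i \<epsilon>)"
    unfolding eventually_at using assms(6) by (auto simp: p_def q_def \<kappa>_def intro!: exI[of _ 1])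
  have limit_system: "cluster_system {1..N} p w \<kappa> x"
    if G: "G \<le> ?F" "G \<noteq> bot" and x: "\<And>i. i \<in> {1..N} \<Longrightarrow> (y i \<longlongrightarrow> x i) G" for G x
    using cluster_system_limit[OF G(2) filter_leD[OF G(1) nz] x[unfolded y_def]
      tendsto_mono[OF G(1) v] tendsto_mono[OF G(1) q] tendsto_mono[OF G(1) q1]
      filter_leD[OF G(1) qprod] filter_leD[OF G(1) bethe]] .
  obtain K where K: "\<forall>\<^sub>F \<epsilon> in ?F. \<forall>i\<in>{1..N}. norm (y i \<epsilon>) \<le> K"
    using bethe_solutions_bounded[OF nz p v q q1 qprod bethe] unfolding y_def by auto
  have "\<exists>z. (y i \<longlongrightarrow> z) ?F" if i: "i \<in> {1..N}" for i
  proof (rule tendsto_if_cluster_points_finite)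
    let ?Z = "{u i |u. cluster_system {1..N} p w \<kappa> u}"
    show "finite ?Z" using i p by (intro finite_cluster_solutions) auto
    show "continuous_on E (y i)"
      unfolding y_def using E(2) assms(5)[OF i] by (intro continuous_intros) auto
    fix U assume U: "open U" "?Z \<subseteq> U"
    show "\<forall>\<^sub>F \<epsilon> in ?F. y i \<epsilon> \<in> U"
    proof (rule ccontr)
      assume not: "\<not> ?thesis"
      \<comment> \<open>Along the \<open>\<epsilon>\<close> with \<open>y i \<epsilon> \<notin> U\<close> there would be a cluster point outside \<open>U\<close>, yet its
        coordinate \<open>i\<close> belongs to the candidate set.\<close>
      define F' where "F' = inf ?F (principal {\<epsilon>. y i \<epsilon> \<notin> U})"
      have "F' \<noteq> bot"
        using not by (auto simp: F'_def trivial_limit_def eventually_inf_principal)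
      moreover have F': "F' \<le> ?F" by (simp add: F'_def)
      moreover have "\<forall>\<^sub>F \<epsilon> in F'. y j \<epsilon> \<in> cball 0 K" if "j \<in> {1..N}" for j
        using filter_leD[OF F' K] by eventually_elim (use that in auto)
      ultimately obtain G x where G: "G \<le> F'" "G \<noteq> bot"
        and x: "\<And>j. j \<in> {1..N} \<Longrightarrow> (y j \<longlongrightarrow> x j) G"
        using convergent_subfilter[of "{1..N}" F' "cball 0 K" y] by auto
      have "cluster_system {1..N} p w \<kappa> x"
        using limit_system[of G x] G F' x by auto
      then have "x i \<in> U" using U(2) by auto
      then have "\<forall>\<^sub>F \<epsilon> in G. y i \<epsilon> \<in> U" using x[OF i] U(1) topological_tendstoD by blast
      moreover have "\<forall>\<^sub>F \<epsilon> in F'. y i \<epsilon> \<notin> U" by (simp add: F'_def eventually_inf_principal)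
      then have "\<forall>\<^sub>F \<epsilon> in G. y i \<epsilon> \<notin> U" by (rule filter_leD[OF G(1)])
      ultimately have "\<forall>\<^sub>F \<epsilon> in G. False" by eventually_elim simp
      with G(2) show False by (simp add: trivial_limit_def)
    qed
  qed (use E in auto)
  then obtain u where u: "\<And>i. i \<in> {1..N} \<Longrightarrow> (y i \<longlongrightarrow> u i) ?F" by metis
  then have sys: "cluster_system {1..N} p w \<kappa> u"
    using limit_system[of ?F u] E(1) by auto
  have eq: "ilw_num N r \<tau> w u i = - ilw_den N r w u i" if i: "i \<in> {1..N}" for i
  proof -
    have three: "(\<Prod>a\<in>{1..3}. f a) = f 1 * f 2 * f 3" for f :: "nat \<Rightarrow> complex"
      by (simp add: numeral_3_eq_3 numeral_2_eq_2)
    have rest: "(\<Prod>j\<in>{1..N}. f j) = f i * (\<Prod>j\<in>{1..N} - {i}. f j)" for f :: "nat \<Rightarrow> complex"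
      using i by (intro prod.remove) auto
    have num_factor: "(z - 1) * (z + of_real r) * (z - of_real r + 1) = (\<Prod>a\<in>{1..3}. z + \<kappa> a)" for z
      unfolding three by (simp add: \<kappa>_def algebra_simps)
    have den_factor: "(z + 1) * (z - of_real r) * (z + of_real r - 1) = (\<Prod>a\<in>{1..3}. z - \<kappa> a)" for z
      unfolding three by (simp add: \<kappa>_def algebra_simps)
    \<comment> \<open>The factor \<open>j = i\<close> of the numerator and of the denominator, which the equation of \<open>{i}\<close> does
      not contain, gives opposite constants and thereby the sign in the claim.\<close>
    have diag: "(\<Prod>a\<in>{1..3}. u i - u i + \<kappa> a) = of_real (r * (r - 1))"
      "(\<Prod>a\<in>{1..3}. u i - u i - \<kappa> a) = - of_real (r * (r - 1))"
      unfolding three by (simp_all add: \<kappa>_def algebra_simps)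
    let ?cp = "cluster_prod {1..N} {i}"
    have "ilw_num N r \<tau> w u i =
        of_real (r * (r - 1)) * (p * ?cp (\<lambda>i s. u i - w s) (\<lambda>i j a. u i - u j + \<kappa> a))"
      unfolding ilw_num_def num_factor rest diag cluster_prod_def by (simp add: p_def)
    moreover have "ilw_den N r w u i =
        - of_real (r * (r - 1)) * ?cp (\<lambda>i s. u i - w s + \<kappa> 2) (\<lambda>i j a. u i - u j - \<kappa> a)"
      unfolding ilw_den_def den_factor rest diag cluster_prod_def by (simp add: \<kappa>_def)
    moreover have "p * ?cp (\<lambda>i s. u i - w s) (\<lambda>i j a. u i - u j + \<kappa> a) =
        ?cp (\<lambda>i s. u i - w s + \<kappa> 2) (\<lambda>i j a. u i - u j - \<kappa> a)"
      using sys i unfolding cluster_system_def by (auto dest: spec[of _ "{i}"])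
    ultimately show ?thesis by simp
  qed
  show ?thesis
  proof (intro exI[of _ u] conjI ballI impI)
    fix i assume i: "i \<in> {1..N}"
    show "(\<lambda>\<epsilon>. t i \<epsilon> - (1 + u i * of_real \<epsilon>)) \<in> o[at 0 within E](\<lambda>\<epsilon>. of_real \<epsilon>)"
      using u[OF i] unfolding has_linear_approximation_iff y_def .
    show "ilw_num N r \<tau> w u i = - ilw_den N r w u i" by (rule eq[OF i])
    then show "ilw_lhs N r \<tau> w u i = -1" if "ilw_den N r w u i \<noteq> 0"
      using that by (simp add: ilw_lhs_eq)
  qed
qed

end
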